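(* Let $n\ge 1$. If $\lambda=(\lambda_1,\dots,\lambda_n)^\top\in\operatorname{coni}(M_n)$ and $\Lambda=\{\lambda_1,\dots,\lambda_n\}$ is the list (multiset) of its entries, then $\Lambda$ is symmetrically realizable, i.e. there is an $n\times n$ real, symmetric, entrywise nonnegative matrix whose spectrum (counting multiplicities) is $\Lambda$.
   Context: Let $M_1:=[1]$ and, for $n>1$, $M_n:=\begin{bmatrix}1&e^\top\\ e&-I\end{bmatrix}\in M_n(\mathbb{R})$, where $e\in\mathbb{R}^{n-1}$ is the all-ones column vector and $I$ is the identity matrix of order $n-1$. $\operatorname{coni}(M_n):=\{M_ny\mid y\in\mathbb{R}^n,\ y\ge 0\}$, where $y\ge0$ is entrywise; it is the conical hull of the columns of $M_n$. *)

theory Defs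
  imports "Jordan_Normal_Form.Char_Poly" Complex_Main
begin

definition M :: "nat \<Rightarrow> real mat" where
  "M n = (if n = 1 then 1\<^sub>m 1
     else four_block_mat
       (1\<^sub>m 1)               (mat 1 (n - 1) (\<lambda>_. 1))
       (mat (n - 1) 1 (\<lambda>_. 1)) (- 1\<^sub>m (n - 1)))"

(* The order on vectors is the componentwise one from Jordan_Normal_Form.Matrix. *)
definition coni :: "real mat \<Rightarrow> real vec set" where
  "coni A = {A *\<^sub>v y | y. y \<in> carrier_vec (dim_col A) \<and> 0\<^sub>v (dim_col A) \<le> y}"

definition entries :: "'a vec \<Rightarrow> 'a multiset" where
  "entries v = mset (list_of_vec v)"

definition nonneg_mat :: "real mat \<Rightarrow> bool" where
  "nonneg_mat A \<longleftrightarrow> (\<forall>i<dim_row A. \<forall>j<dim_col A. 0 \<le> A $$ (i, j))"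

(* All complex eigenvalues, with algebraic multiplicity; for an n x n matrix the multiset
   has size n. *)
definition spectrum_mset :: "real mat \<Rightarrow> complex multiset" where
  "spectrum_mset A = proots (char_poly (map_mat complex_of_real A))"

(* The order of the realizing matrix is the size of the list. *)
definition symmetrically_realizable :: "real multiset \<Rightarrow> bool" where
  "symmetrically_realizable \<Lambda> \<longleftrightarrow>
     (\<exists>A \<in> carrier_mat (size \<Lambda>) (size \<Lambda>).
        transpose_mat A = A \<and> nonneg_mat A \<and>
        spectrum_mset A = image_mset complex_of_real \<Lambda>)"

end

theory Submission
  imports Defs
begin

text \<open>
  Since \<open>l = M n y\<close> means \<open>l\<^sub>1 = \<Sum>y\<close> and \<open>l\<^sub>i = y\<^sub>1 - y\<^sub>i\<close> for \<open>i > 1\<close>, the list is a trace-zero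
  Suleimanova list shifted by \<open>y\<^sub>1 \<ge> 0\<close>. Following Fiedler, such lists are realized by bordering: if
  \<open>u \<ge> 0\<close> is a unit eigenvector of \<open>A\<close> for the eigenvalue \<open>t + s\<close>, then appending to \<open>A\<close> the column
  \<open>\<rho> u\<close>, its transpose and the diagonal entry \<open>t\<close>, with \<open>\<rho>\<^sup>2 = y (s + y)\<close>, replaces \<open>t + s\<close> by the two
  eigenvalues \<open>t + s + y\<close> and \<open>t - y\<close>. The eigenvectors are recorded as an orthogonal matrix, whose
  last update is a plane rotation of \<open>u\<close> against the new coordinate vector.
\<close>

lemma rotation_weights:
  fixes s y :: real
  assumes "0 \<le> s" "0 \<le> y"
  obtains c d where "0 \<le> c" "0 \<le> d" "c\<^sup>2 + d\<^sup>2 = 1" "(s + 2 * y) * c\<^sup>2 = s + y"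
    "(s + 2 * y) * d\<^sup>2 = y"
proof (cases "s + 2 * y = 0")
  case True
  then have "s = 0" "y = 0" using assms by auto
  then show ?thesis using that[of 1 0] by simp
next
  case False
  then have "0 < s + 2 * y" using assms by simp
  then show ?thesis
    using assms by (intro that[of "sqrt ((s + y) / (s + 2 * y))" "sqrt (y / (s + 2 * y))"])
      (auto simp: add_divide_distrib[symmetric])
qed

text \<open>The sign condition on column 0 carries the induction: that column is the eigenvector
  from which the next border is built. Matrices are functions on indices, so that bordering needs no
  reindexing.\<close>

lemma orthogonal_matrix_with_nonneg_conjugate:
  fixes y :: "nat \<Rightarrow> real" and t :: real
  assumes y: "\<And>i. 0 \<le> y i" and t: "0 \<le> t"
  defines "ev \<equiv> \<lambda>n k. if k = 0 then t + (\<Sum>i = 1..n. y i) else t - y k"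
  shows "\<exists>Q. (\<forall>i\<le>n. 0 \<le> Q i 0) \<and>
    (\<forall>k\<le>n. \<forall>m\<le>n. (\<Sum>i\<le>n. Q i k * Q i m) = (if k = m then 1 else 0)) \<and>
    (\<forall>i\<le>n. \<forall>j\<le>n. 0 \<le> (\<Sum>k\<le>n. ev n k * Q i k * Q j k))"
proof (induction n)
  case 0
  show ?case using t by (intro exI[of _ "\<lambda>_ _. 1"]) (simp add: ev_def)
next
  case (Suc n)
  then obtain Q :: "nat \<Rightarrow> nat \<Rightarrow> real" where
      Q0: "\<And>i. i \<le> n \<Longrightarrow> 0 \<le> Q i 0"
    and orth: "\<And>k m. k \<le> n \<Longrightarrow> m \<le> n \<Longrightarrow> (\<Sum>i\<le>n. Q i k * Q i m) = (if k = m then 1 else 0)"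
    and conj: "\<And>i j. i \<le> n \<Longrightarrow> j \<le> n \<Longrightarrow> 0 \<le> (\<Sum>k\<le>n. ev n k * Q i k * Q j k)"
    by blast
  define s where "s = (\<Sum>i = 1..n. y i)"
  define z where "z = y (Suc n)"
  have "0 \<le> s" "0 \<le> z" unfolding s_def z_def using y by (auto intro: sum_nonneg)
  obtain c d where cd: "0 \<le> c" "0 \<le> d" "c\<^sup>2 + d\<^sup>2 = 1" "(s + 2 * z) * c\<^sup>2 = s + z"
    "(s + 2 * z) * d\<^sup>2 = z"
    using rotation_weights[OF \<open>0 \<le> s\<close> \<open>0 \<le> z\<close>] by blast
  \<comment> \<open>Extend \<open>Q\<close> by a corner entry 1, then rotate column 0 against the
    new column; columns 1 to \<open>n\<close> are only padded with a zero.\<close>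
  define R where "R i k = (if k = 0 then if i \<le> n then c * Q i 0 else d
      else if k \<le> n then if i \<le> n then Q i k else 0
      else if i \<le> n then - d * Q i 0 else c)" for i k
  have ev_Suc: "ev (Suc n) 0 = t + s + z" "ev n (Suc n) = t - z"
    "\<And>k. ev (Suc n) (Suc k) = ev n (Suc k)" "ev n 0 = t + s"
    by (simp_all add: ev_def s_def z_def)
  have "t * (c\<^sup>2 + d\<^sup>2) = t" "z * (c\<^sup>2 + d\<^sup>2) = z"
    using cd(3) by simp_all
  \<comment> \<open>The diagonal entries of the 2 by 2 matrix obtained by rotating the diagonal
    matrix with entries \<open>t + s + z\<close> and \<open>t - z\<close>.\<close>
  then have top: "(t + s + z) * c\<^sup>2 + (t - z) * d\<^sup>2 = t + s"
    and bot: "(t + s + z) * d\<^sup>2 + (t - z) * c\<^sup>2 = t"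
    using cd(4,5) unfolding distrib_left distrib_right left_diff_distrib by linarith+
  have split0: "(\<Sum>k\<le>n. f k) = f 0 + (\<Sum>k<n. f (Suc k))" for f :: "nat \<Rightarrow> real"
    by (simp add: sum.atMost_shift)
  have R0: "0 \<le> R i 0" if "i \<le> Suc n" for i
    using Q0 cd that by (simp add: R_def)
  have orthR: "(\<Sum>i\<le>Suc n. R i k * R i m) = (if k = m then 1 else 0)"
    if "k \<le> Suc n" "m \<le> Suc n" for k m
  proof -
    have cc: "c * c + d * d = 1" "d * d + c * c = 1" using cd(3) by (simp_all add: power2_eq_square)
    \<comment> \<open>Without its last entry, column \<open>k\<close> of \<open>R\<close> is
      \<open>a k\<close> times column \<open>p k\<close> of \<open>Q\<close>; columns 0 and
      \<open>Suc n\<close> both come from column 0. The last row then completes the sums to those of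
      a rotation.\<close>
    define a where "a k = (if k = 0 then c else if k \<le> n then 1 else - d)" for k
    define p where "p k = (if k \<le> n then k else 0)" for k
    have "(\<Sum>i\<le>n. R i k * R i m) = (\<Sum>i\<le>n. (a k * a m) * (Q i (p k) * Q i (p m)))"
      by (intro sum.cong) (auto simp: R_def a_def p_def)
    also have "\<dots> = a k * a m * (if p k = p m then 1 else 0)"
      using orth[of "p k" "p m"] by (simp add: sum_distrib_left[symmetric] p_def)
    finally show ?thesis
      using that cc by (auto simp: R_def a_def p_def)
  qed
  have conjR: "0 \<le> (\<Sum>k\<le>Suc n. ev (Suc n) k * R i k * R j k)"
    if ij: "i \<le> Suc n" "j \<le> Suc n" for i j
  proof -
    have expand: "(\<Sum>k\<le>Suc n. ev (Suc n) k * R i k * R j k) =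
        (t + s + z) * R i 0 * R j 0 + (\<Sum>k<n. ev n (Suc k) * R i (Suc k) * R j (Suc k))
        + (t - z) * R i (Suc n) * R j (Suc n)"
      by (simp add: split0 ev_Suc)
    consider "i \<le> n" "j \<le> n" | "i \<le> n" "j = Suc n" | "i = Suc n" "j \<le> n" | "i = Suc n" "j = Suc n"
      using ij le_SucE by metis
    then show ?thesis
    proof cases
      case 1
      \<comment> \<open>By \<open>top\<close>, the old block is left unchanged, so the induction
        hypothesis applies.\<close>
      have "(\<Sum>k\<le>Suc n. ev (Suc n) k * R i k * R j k) =
          ((t + s + z) * c\<^sup>2 + (t - z) * d\<^sup>2) * Q i 0 * Q j 0 +
          (\<Sum>k<n. ev n (Suc k) * Q i (Suc k) * Q j (Suc k))"
        unfolding expand using 1 by (simp add: R_def power2_eq_square algebra_simps)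
      also have "\<dots> = (\<Sum>k\<le>n. ev n k * Q i k * Q j k)"
        by (simp add: top split0 ev_Suc)
      finally show ?thesis using conj 1 by simp
    next
      case 2
      \<comment> \<open>The padded columns vanish in the last row and \<open>t\<close> cancels
        between the two rotated ones, so the border is a nonnegative multiple of column 0 of
        \<open>Q\<close>.\<close>
      have "(\<Sum>k\<le>Suc n. ev (Suc n) k * R i k * R j k) = (s + 2 * z) * (c * d * Q i 0)"
        unfolding expand using 2 by (simp add: R_def algebra_simps)
      then show ?thesis using Q0 2 cd \<open>0 \<le> s\<close> \<open>0 \<le> z\<close> by simp
    next
      case 3
      have "(\<Sum>k\<le>Suc n. ev (Suc n) k * R i k * R j k) = (s + 2 * z) * (c * d * Q j 0)"
        unfolding expand using 3 by (simp add: R_def algebra_simps)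
      then show ?thesis using Q0 3 cd \<open>0 \<le> s\<close> \<open>0 \<le> z\<close> by simp
    next
      case 4
      have "(\<Sum>k\<le>Suc n. ev (Suc n) k * R i k * R j k) = (t + s + z) * d\<^sup>2 + (t - z) * c\<^sup>2"
        unfolding expand using 4 by (simp add: R_def power2_eq_square)
      then show ?thesis using bot t by simp
    qed
  qed
  show ?case using R0 orthR conjR by blast
qed

lemma M_index:
  assumes "i < n" "j < n"
  shows "M n $$ (i, j) = (if i = 0 \<or> j = 0 then 1 else if i = j then - 1 else 0)"
  using assms by (auto simp: M_def)

lemma M_carrier: "1 \<le> n \<Longrightarrow> M n \<in> carrier_mat n n"
  by (rule carrier_matI) (simp_all add: M_def)

lemma proots_prod_list_linear:
  "proots (\<Prod>a\<leftarrow>xs. [:- a, 1:]) = mset (xs :: 'a :: idom list)"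
proof (induction xs)
  case (Cons a xs)
  have "(\<Prod>a\<leftarrow>xs. [:- a, 1:]) \<noteq> 0" by (auto simp: prod_list_zero_iff)
  then show ?case using Cons by (simp add: proots_mult del: mult_pCons_left)
qed simp

text \<open>Orthogonality makes the matrix similar to the diagonal one over the reals; the equality
  of characteristic polynomials is then carried over to the complex numbers.\<close>

lemma spectrum_mset_orthogonal_conjugate:
  assumes Q: "Q \<in> carrier_mat n n" and QQ: "transpose_mat Q * Q = 1\<^sub>m n"
    and l: "l \<in> carrier_vec n"
  shows "spectrum_mset (Q * mat_diag n (($) l) * transpose_mat Q) = image_mset complex_of_real (entries l)"
proof -
  let ?D = "mat_diag n (($) l)"
  let ?A = "Q * ?D * transpose_mat Q"
  have D: "?D \<in> carrier_mat n n" by simp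
  have "Q * transpose_mat Q = 1\<^sub>m n"
    using mat_mult_left_right_inverse[OF _ Q QQ] Q by simp
  then have "similar_mat_wit ?A ?D Q (transpose_mat Q)"
    using Q D QQ by (intro similar_mat_witI) auto
  then have "char_poly ?A = char_poly ?D"
    using char_poly_similar similar_mat_def by blast
  moreover have "char_poly (map_mat complex_of_real B) = map_poly complex_of_real (char_poly B)"
    if "B \<in> carrier_mat n n" for B
    using of_real_hom.char_poly_hom[OF that] .
  ultimately have "char_poly (map_mat complex_of_real ?A) = char_poly (map_mat complex_of_real ?D)"
    using Q D by (metis mult_carrier_mat transpose_carrier_mat)
  also have "\<dots> = (\<Prod>a\<leftarrow>diag_mat (map_mat complex_of_real ?D). [:- a, 1:])"
    by (rule char_poly_upper_triangular[of _ n]) (auto simp: mat_diag_def)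
  also have "diag_mat (map_mat complex_of_real ?D) = map complex_of_real (list_of_vec l)"
    using l by (auto simp: diag_mat_def mat_diag_def list_of_vec_map)
  finally show ?thesis
    unfolding spectrum_mset_def entries_def by (simp only: proots_prod_list_linear mset_map)
qed

theorem theorem6p3:
  fixes n :: nat and l :: "real vec"
  assumes "n \<ge> 1"
    and "l \<in> coni (M n)"
  shows "symmetrically_realizable (entries l)"
proof -
  obtain n' where n: "n = Suc n'" using assms(1) by (cases n) auto
  have dimM: "dim_row (M n) = n" "dim_col (M n) = n" using M_carrier[OF assms(1)] by auto
  obtain v where v: "v \<in> carrier_vec n" "0\<^sub>v n \<le> v" and lv: "l = M n *\<^sub>v v"
    using assms(2) by (auto simp: coni_def dimM)
  have l: "l \<in> carrier_vec n" unfolding lv by (rule mult_mat_vec_carrier[OF M_carrier[OF assms(1)] v(1)])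
  \<comment> \<open>Extension by zero gives nonnegativity at every index, as the inductive lemma
    demands.\<close>
  define y where "y i = (if i < n then v $ i else 0)" for i
  have y: "0 \<le> y i" for i using v by (auto simp: y_def less_eq_vec_def)
  \<comment> \<open>The eigenvalue list of the inductive lemma with \<open>t = y 0\<close>; its
    indices 0 to \<open>n'\<close> match the \<open>n = Suc n'\<close> entries of
    \<open>l\<close>.\<close>
  define ev where "ev k = (if k = 0 then y 0 + (\<Sum>i = 1..n'. y i) else y 0 - y k)" for k
  have l_ev: "l $ k = ev k" if "k < n" for k
  proof -
    have "l $ k = (\<Sum>i<n. M n $$ (k, i) * v $ i)"
      using that v(1) dimM by (simp add: lv scalar_prod_def lessThan_atLeast0)
    also have "\<dots> = (\<Sum>i<n. (if k = 0 \<or> i = 0 then 1 else if k = i then - 1 else 0) * y i)"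
      using that by (intro sum.cong) (auto simp: M_index y_def)
    also have "\<dots> = y 0 + (\<Sum>i = 1..n'. (if k = 0 then 1 else if k = i then - 1 else 0) * y i)"
      unfolding n sum.lessThan_Suc_shift by (simp add: sum.atLeast1_atMost_eq)
    also have "\<dots> = ev k"
    proof (cases "k = 0")
      case False
      then have "(\<Sum>i = 1..n'. (if k = 0 then 1 else if k = i then - 1 else 0) * y i)
          = (\<Sum>i = 1..n'. if k = i then - y i else 0)"
        by (intro sum.cong) auto
      also have "\<dots> = - y k" using False that n by (subst sum.delta') auto
      finally show ?thesis using False by (simp add: ev_def)
    qed (simp add: ev_def)
    finally show ?thesis .
  qed
  obtain q :: "nat \<Rightarrow> nat \<Rightarrow> real" where
      orth: "\<And>k m. k < n \<Longrightarrow> m < n \<Longrightarrow> (\<Sum>i<n. q i k * q i m) = (if k = m then 1 else 0)"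
    and conj: "\<And>i j. i < n \<Longrightarrow> j < n \<Longrightarrow> 0 \<le> (\<Sum>k<n. ev k * q i k * q j k)"
    using orthogonal_matrix_with_nonneg_conjugate[of y "y 0" n'] y
    unfolding n ev_def less_Suc_eq_le lessThan_Suc_atMost by blast
  define Q where "Q = mat n n (\<lambda>(i, j). q i j)"
  define A where "A = Q * mat_diag n (($) l) * transpose_mat Q"
  have Q: "Q \<in> carrier_mat n n" by (simp add: Q_def)
  then have A: "A \<in> carrier_mat n n" unfolding A_def by auto
  have QQ: "transpose_mat Q * Q = 1\<^sub>m n"
    using orth by (intro eq_matI) (auto simp: Q_def scalar_prod_def lessThan_atLeast0)
  have A_index: "A $$ (i, j) = (\<Sum>k<n. ev k * q i k * q j k)" if "i < n" "j < n" for i j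
  proof -
    have "Q * mat_diag n (($) l) = mat n n (\<lambda>(i, k). q i k * l $ k)"
      using mat_diag_mult_right[OF Q] by (auto simp: Q_def)
    then have "A $$ (i, j) = (\<Sum>k<n. q i k * l $ k * q j k)"
      using that by (simp add: A_def Q_def scalar_prod_def lessThan_atLeast0)
    also have "\<dots> = (\<Sum>k<n. ev k * q i k * q j k)"
      by (intro sum.cong) (auto simp: l_ev)
    finally show ?thesis .
  qed
  have "transpose_mat A = A"
    using A by (intro eq_matI) (auto simp: A_index mult.assoc mult.commute mult.left_commute)
  moreover have "nonneg_mat A"
    using A conj by (auto simp: nonneg_mat_def A_index)
  moreover have "spectrum_mset A = image_mset complex_of_real (entries l)"
    unfolding A_def by (rule spectrum_mset_orthogonal_conjugate[OF Q QQ l])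
  moreover have "size (entries l) = n" using l by (simp add: entries_def)
  ultimately show ?thesis using A unfolding symmetrically_realizable_def by blast
qed

end
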